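(* For $n\ge 1$, let $SU(n+1)$ be endowed with its standard bi-invariant Riemannian metric and let $\mu_n$ be its normalised invariant (Haar) measure. Consider the fibration $U(n)\hookrightarrow SU(n+1)\xrightarrow{\ \pi_n\ }\mathbb{CP}^n=SU(n+1)/U(n)$, let $S_n\subset\mathbb{CP}^n$ be the hyperplane at infinity, with embedding $\iota:S_n\hookrightarrow\mathbb{CP}^n$, and let $\Sigma_n=\iota^*(SU(n+1))=\pi_n^{-1}(S_n)\subset SU(n+1)$ be the restriction of the fibration to $S_n$, which is a subvariety of real codimension $2$. Then the measure concentrates on $\Sigma_n$ with constant $\varepsilon$: for every fixed $\varepsilon>0$, if $U_n^{\varepsilon}$ denotes the tubular neighbourhood of $\Sigma_n$ of radius $\varepsilon$ in $SU(n+1)$, then $$\lim_{n\to\infty}\mu_n\big(SU(n+1)\setminus U_n^{\varepsilon}\big)=0 .$$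
   Context: The standard bi-invariant metric on $SU(n+1)$ is the bi-invariant Riemannian metric whose value at the identity is $\langle X,Y\rangle=-\tfrac12\mathrm{Tr}(XY)$ for $X,Y\in\mathfrak{su}(n+1)$ (traceless anti-hermitian matrices). The projection is $\pi_n(g)=[g e_0]$, where $e_0,\dots,e_n$ is the canonical basis of $\mathbb C^{n+1}$; the stabiliser of the line $[e_0]$ is a copy of $U(n)$. With homogeneous coordinates $(\zeta_0:\cdots:\zeta_n)$ on $\mathbb{CP}^n$, the hyperplane at infinity is $S_n=\{\zeta_0=0\}\cong\mathbb{CP}^{n-1}$. The tubular neighbourhood of radius $\varepsilon$ of a closed subset is the set of points at Riemannian distance less than $\varepsilon$ from it. *)

theory Defs
  imports
    "HOL-Analysis.Analysis"
    "Jordan_Normal_Form.Schur_Decomposition"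
begin

definition SU :: "nat \<Rightarrow> complex mat set" where
  "SU N = {g \<in> carrier_mat N N. mat_adjoint g * g = 1\<^sub>m N \<and> det g = 1}"

text \<open>The topology of \<^term>\<open>SU N\<close> is the subspace topology from the space of
  complex \<open>N \<times> N\<close> matrices, that is, from the product of \<open>N\<^sup>2\<close> copies of the complex plane.
  The type of matrices of all sizes carries no topology of its own.\<close>

definition SU_topology :: "nat \<Rightarrow> complex mat topology" where
  "SU_topology N =
     pullback_topology (SU N) (\<lambda>A. \<lambda>p\<in>{..<N} \<times> {..<N}. A $$ p)
       (product_topology (\<lambda>_. euclidean) ({..<N} \<times> {..<N}))"

text \<open>Left invariance suffices: for a compact group it implies right invariance
  and determines the Borel probability measure.\<close>

definition normalised_Haar_SU :: "nat \<Rightarrow> complex mat measure \<Rightarrow> bool" where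
  "normalised_Haar_SU N \<mu> \<longleftrightarrow>
     space \<mu> = SU N \<and>
     sets \<mu> = sigma_sets (SU N) {U. openin (SU_topology N) U} \<and>
     emeasure \<mu> (SU N) = 1 \<and>
     (\<forall>g\<in>SU N. \<forall>A\<in>sets \<mu>. emeasure \<mu> ((\<lambda>h. g * h) ` A) = emeasure \<mu> A)"

definition mat_trace :: "complex mat \<Rightarrow> complex" where
  "mat_trace A = (\<Sum>i<dim_row A. A $$ (i, i))"

definition su_inner :: "complex mat \<Rightarrow> complex mat \<Rightarrow> real" where
  "su_inner X Y = Re (- mat_trace (X * Y) / 2)"

text \<open>Tangent vectors at \<open>g\<close> are the matrices \<open>g X\<close> with \<open>X\<close> in the Lie algebra; they are
  moved to the identity by left translation with the inverse of \<open>g\<close>, which is its adjoint.\<close>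

definition SU_metric :: "complex mat \<Rightarrow> complex mat \<Rightarrow> complex mat \<Rightarrow> real" where
  "SU_metric g V W = su_inner (mat_adjoint g * V) (mat_adjoint g * W)"

definition mat_velocity :: "nat \<Rightarrow> (real \<Rightarrow> complex mat) \<Rightarrow> real \<Rightarrow> complex mat" where
  "mat_velocity N \<gamma> t =
     mat N N (\<lambda>(i, j). vector_derivative (\<lambda>s. \<gamma> s $$ (i, j)) (at t))"

definition SU_paths :: "nat \<Rightarrow> complex mat \<Rightarrow> complex mat \<Rightarrow> (real \<Rightarrow> complex mat) set" where
  "SU_paths N g h =
     {\<gamma>. \<gamma> \<in> {0..1} \<rightarrow> SU N \<and> \<gamma> 0 = g \<and> \<gamma> 1 = h \<and>
         (\<forall>i<N. \<forall>j<N. (\<lambda>t. \<gamma> t $$ (i, j)) piecewise_C1_differentiable_on {0..1})}"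

text \<open>Lengths are extended nonnegative reals because \<^const>\<open>piecewise_C1_differentiable_on\<close>
  does not bound the derivative near the break points: a curve of infinite length must get
  length \<open>\<infinity>\<close>, whereas a real-valued integral would assign it \<open>0\<close>.
  The finitely many break points do not affect the integral.\<close>

definition SU_length :: "nat \<Rightarrow> (real \<Rightarrow> complex mat) \<Rightarrow> ennreal" where
  "SU_length N \<gamma> =
     (\<integral>\<^sup>+ t\<in>{0..1}.
        ennreal (sqrt (SU_metric (\<gamma> t) (mat_velocity N \<gamma> t) (mat_velocity N \<gamma> t))) \<partial>lborel)"

definition SU_dist :: "nat \<Rightarrow> complex mat \<Rightarrow> complex mat \<Rightarrow> ennreal" where
  "SU_dist N g h = (INF \<gamma>\<in>SU_paths N g h. SU_length N \<gamma>)"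

definition tubular_nbhd :: "nat \<Rightarrow> complex mat set \<Rightarrow> real \<Rightarrow> complex mat set" where
  "tubular_nbhd N S \<epsilon> = {g \<in> SU N. (INF s\<in>S. SU_dist N g s) < ennreal \<epsilon>}"

text \<open>A point of projective space is the class of a nonzero vector up to nonzero scalars.\<close>

definition proj_point :: "complex vec \<Rightarrow> complex vec set" where
  "proj_point v = {c \<cdot>\<^sub>v v | c. c \<noteq> 0}"

definition CP :: "nat \<Rightarrow> complex vec set set" where
  "CP n = {proj_point v | v. v \<in> carrier_vec (n + 1) \<and> v \<noteq> 0\<^sub>v (n + 1)}"

definition hyperplane_at_infinity :: "nat \<Rightarrow> complex vec set set" where
  "hyperplane_at_infinity n = {P \<in> CP n. \<forall>v\<in>P. v $ 0 = 0}"

definition SU_proj :: "nat \<Rightarrow> complex mat \<Rightarrow> complex vec set" where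
  "SU_proj n g = proj_point (g *\<^sub>v unit_vec (n + 1) 0)"

definition SU_over_infinity :: "nat \<Rightarrow> complex mat set" where
  "SU_over_infinity n = {g \<in> SU (n + 1). SU_proj n g \<in> hyperplane_at_infinity n}"

end

theory Submission
  imports Defs
begin

text \<open>
  Write \<open>N = n + 1\<close>. A matrix \<open>g\<close> lies over the hyperplane at infinity when its corner entry
  \<open>g\<^sub>0\<^sub>0\<close> vanishes, so concentration on that set follows from two facts: \<open>|g\<^sub>0\<^sub>0|\<close> controls the
  distance to it, and \<open>|g\<^sub>0\<^sub>0|\<close> is small with high probability.

  Distance (\<open>exists_close_point_over_infinity\<close>). If \<open>|g\<^sub>0\<^sub>0| = sin \<theta> < 1\<close>, there is a
  unit vector \<open>u\<close> orthogonal to \<open>e\<^sub>0\<close> such that rotating by \<open>\<theta>\<close> in the plane of \<open>e\<^sub>0\<close> and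
  \<open>u\<close> carries \<open>e\<^sub>0\<close> to a vector annihilated by row \<open>0\<close> of \<open>g\<close>. The path that multiplies \<open>g\<close>
  on the right by this rotation, with the angle growing from \<open>0\<close> to \<open>\<theta>\<close>, has constant speed
  \<open>\<theta>\<close>, because the inner product \<open>-Tr(XY)/2\<close> gives the infinitesimal rotation norm \<open>1\<close>.
  Hence the distance is at most \<open>arcsin |g\<^sub>0\<^sub>0|\<close>, and a matrix outside the tube of radius \<open>\<epsilon>\<close> has
  \<open>|g\<^sub>0\<^sub>0| \<ge> sin (min \<epsilon> 1)\<close>.

  Probability (\<open>Haar_large_entry_le\<close>). Left translation by a rotation taking \<open>e\<^sub>0\<close> to \<open>e\<^sub>i\<close>
  shows that all \<open>N\<close> entries of column \<open>0\<close> are equally likely to have modulus at least \<open>\<delta>\<close>.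
  Since the column is a unit vector, at most \<open>1/\<delta>\<^sup>2\<close> of them do so at once; therefore each does
  with probability at most \<open>1/(\<delta>\<^sup>2 N)\<close>, which tends to \<open>0\<close> with \<open>\<delta> = sin (min \<epsilon> 1)\<close> fixed.
\<close>

section \<open>Adjoints and the special unitary group\<close>

lemma index_mat_adjoint:
  assumes "i < dim_col A" "j < dim_row A"
  shows "mat_adjoint A $$ (i, j) = cnj (A $$ (j, i))"
  using assms unfolding mat_adjoint_def by (simp add: mat_of_rows_def)

lemma dim_mat_adjoint: "dim_row (mat_adjoint A) = dim_col A" "dim_col (mat_adjoint A) = dim_row A"
  unfolding mat_adjoint_def by auto

lemma index_mult_mat_sum:
  assumes "A \<in> carrier_mat N N" "B \<in> carrier_mat N N" "i < N" "j < N"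
  shows "(A * B) $$ (i, j) = (\<Sum>k<N. A $$ (i, k) * B $$ (k, j))"
  using assms by (auto simp: scalar_prod_def lessThan_atLeast0)

lemma mat_adjoint_carrier:
  "A \<in> carrier_mat m n \<Longrightarrow> mat_adjoint A \<in> carrier_mat n m"
  by (auto simp: dim_mat_adjoint)

lemma mat_adjoint_adjoint: "mat_adjoint (mat_adjoint A) = (A :: complex mat)"
  by (rule eq_matI) (auto simp: dim_mat_adjoint index_mat_adjoint)

lemma mat_adjoint_mult:
  assumes A: "A \<in> carrier_mat N N" and B: "B \<in> carrier_mat N N"
  shows "mat_adjoint (A * B) = mat_adjoint B * (mat_adjoint A :: complex mat)"
proof (rule eq_matI)
  fix i j assume "i < dim_row (mat_adjoint B * mat_adjoint A)" "j < dim_col (mat_adjoint B * mat_adjoint A)"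
  then have ij: "i < N" "j < N" using A B by (auto simp: dim_mat_adjoint)
  have "mat_adjoint (A * B) $$ (i, j) = cnj ((A * B) $$ (j, i))"
    using A B ij by (intro index_mat_adjoint) auto
  also have "\<dots> = (\<Sum>k<N. mat_adjoint B $$ (i, k) * mat_adjoint A $$ (k, j))"
    unfolding index_mult_mat_sum[OF A B ij(2,1)] using A B ij
    by (auto simp: index_mat_adjoint mult.commute intro!: sum.cong)
  also have "\<dots> = (mat_adjoint B * mat_adjoint A) $$ (i, j)"
    by (rule index_mult_mat_sum[OF mat_adjoint_carrier[OF B] mat_adjoint_carrier[OF A] ij, symmetric])
  finally show "mat_adjoint (A * B) $$ (i, j) = (mat_adjoint B * mat_adjoint A) $$ (i, j)" .
qed (use A B in \<open>auto simp: dim_mat_adjoint\<close>)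

lemma SU_carrier: "g \<in> SU N \<Longrightarrow> g \<in> carrier_mat N N"
  by (simp add: SU_def)

lemma SU_right_inverse: "g \<in> SU N \<Longrightarrow> g * mat_adjoint g = 1\<^sub>m N"
  unfolding SU_def using mat_mult_left_right_inverse mat_adjoint_carrier by blast

lemma SU_mult:
  assumes g: "g \<in> SU N" and h: "h \<in> SU N"
  shows "g * h \<in> SU N"
proof -
  note c = SU_carrier[OF g] SU_carrier[OF h]
  note a = mat_adjoint_carrier[OF c(1)] mat_adjoint_carrier[OF c(2)]
  have "mat_adjoint (g * h) * (g * h) = mat_adjoint h * ((mat_adjoint g * g) * h)"
    using a c by (simp add: mat_adjoint_mult[OF c] assoc_mult_mat[of _ N N _ N _ N])
  also have "\<dots> = 1\<^sub>m N" using g h c by (simp add: SU_def)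
  finally show ?thesis using g h c det_mult[OF c] by (simp add: SU_def)
qed

lemma SU_adjoint:
  assumes g: "g \<in> SU N"
  shows "mat_adjoint g \<in> SU N"
proof -
  note c = SU_carrier[OF g] mat_adjoint_carrier[OF SU_carrier[OF g]]
  have "det (g * mat_adjoint g) = det (mat_adjoint g)"
    using det_mult[OF c] g by (simp add: SU_def)
  then show ?thesis
    using c SU_right_inverse[OF g] by (simp add: SU_def mat_adjoint_adjoint)
qed

section \<open>Rotations in a plane through the first basis vector\<close>

text \<open>
  The coordinates \<open>u\<close> of a unit vector orthogonal to \<open>e\<^sub>0\<close> determine the plane spanned by
  \<open>e\<^sub>0\<close> and \<open>u\<close>. General \<open>u\<close> is needed: rotations in planes spanned by two basis vectors
  would not reach the set over infinity along a short path when the mass of row \<open>0\<close> of \<open>g\<close>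
  is spread over many columns.
\<close>

locale coordinate_plane =
  fixes N :: nat and u :: "nat \<Rightarrow> complex"
  assumes u0: "u 0 = 0" and unit: "(\<Sum>k<N. (cmod (u k))\<^sup>2) = 1" and N: "0 < N"
begin

text \<open>The infinitesimal rotation \<open>u e\<^sub>0\<^sup>* - e\<^sub>0 u\<^sup>*\<close>.\<close>

definition gen :: "nat \<Rightarrow> nat \<Rightarrow> complex" where
  "gen i j = (if j = 0 then u i else 0) - (if i = 0 then cnj (u j) else 0)"

text \<open>The orthogonal projection onto the plane.\<close>

definition proj :: "nat \<Rightarrow> nat \<Rightarrow> complex" where
  "proj i j = u i * cnj (u j) + (if i = 0 \<and> j = 0 then 1 else 0)"

text \<open>
  The linear combination of the identity, \<open>gen\<close> and \<open>proj\<close>. These three span a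
  commutative algebra containing the rotations and their derivatives, so all products needed
  later reduce to scalar identities between coefficients.
\<close>

definition comb where
  "comb a b c = mat N N (\<lambda>(i, j). a * (if i = j then 1 else 0) + b * gen i j + c * proj i j)"

lemma sum_uu: "(\<Sum>k<N. u k * cnj (u k)) = 1"
proof -
  have "(\<Sum>k<N. u k * cnj (u k)) = of_real (\<Sum>k<N. (cmod (u k))\<^sup>2)"
    by (simp only: of_real_sum complex_norm_square)
  then show ?thesis by (simp add: unit)
qed

text \<open>On its plane \<open>gen\<close> acts as a quarter turn, and it vanishes on the orthogonal complement;
  hence its square is \<open>- proj\<close> and \<open>proj\<close> acts as a unit on it.\<close>

lemma algebra_relations:
  "(\<Sum>k<N. gen i k * gen k j) = - proj i j"
  "(\<Sum>k<N. gen i k * proj k j) = gen i j"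
  "(\<Sum>k<N. proj i k * gen k j) = gen i j"
  "(\<Sum>k<N. proj i k * proj k j) = proj i j"
proof -
  have d: "(\<Sum>k<N. (if k = 0 then 1 else 0) * f k) = f 0" for f :: "nat \<Rightarrow> complex"
    using N by (subst sum.mono_neutral_right[of _ "{0}"]) auto
  let ?e = "\<lambda>k::nat. if k = 0 then 1 else (0::complex)"
  have g: "gen i j = ?e j * u i - ?e i * cnj (u j)" for i j by (simp add: gen_def)
  have p: "proj i j = u i * cnj (u j) + ?e i * ?e j" for i j by (simp add: proj_def)
  have "(\<Sum>k<N. gen i k * gen k j) = (\<Sum>k<N. ?e k * (?e j * u i * u 0)) - (\<Sum>k<N. ?e k * (u i * cnj (u j)))
     - ?e i * ?e j * (\<Sum>k<N. u k * cnj (u k)) + (\<Sum>k<N. ?e k * (cnj (u k) * ?e i * cnj (u j)))"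
    unfolding g sum_distrib_left sum.distrib[symmetric] sum_subtractf[symmetric]
    by (rule sum.cong) (auto simp: algebra_simps u0)
  then show "(\<Sum>k<N. gen i k * gen k j) = - proj i j" by (simp add: d p sum_uu u0)
  have "(\<Sum>k<N. gen i k * proj k j) = (\<Sum>k<N. ?e k * (u i * u k * cnj (u j))) + (\<Sum>k<N. ?e k * (u i * ?e j))
     - ?e i * cnj (u j) * (\<Sum>k<N. u k * cnj (u k)) - (\<Sum>k<N. ?e k * (cnj (u k) * ?e i * ?e j))"
    unfolding g p sum_distrib_left sum.distrib[symmetric] sum_subtractf[symmetric]
    by (rule sum.cong) (auto simp: algebra_simps u0)
  then show "(\<Sum>k<N. gen i k * proj k j) = gen i j" by (simp add: d g sum_uu u0)
  have "(\<Sum>k<N. proj i k * gen k j) = u i * ?e j * (\<Sum>k<N. u k * cnj (u k)) - (\<Sum>k<N. ?e k * (u i * cnj (u k) * cnj (u j)))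
     + (\<Sum>k<N. ?e k * (?e i * ?e j * u k)) - (\<Sum>k<N. ?e k * (?e i * cnj (u j)))"
    unfolding g p sum_distrib_left sum.distrib[symmetric] sum_subtractf[symmetric]
    by (rule sum.cong) (auto simp: algebra_simps u0)
  then show "(\<Sum>k<N. proj i k * gen k j) = gen i j" by (simp add: d g sum_uu u0)
  have "(\<Sum>k<N. proj i k * proj k j) = u i * cnj (u j) * (\<Sum>k<N. u k * cnj (u k)) + (\<Sum>k<N. ?e k * (u i * cnj (u k) * ?e j))
     + (\<Sum>k<N. ?e k * (?e i * u k * cnj (u j))) + (\<Sum>k<N. ?e k * (?e i * ?e j))"
    unfolding p sum_distrib_left sum.distrib[symmetric] sum_subtractf[symmetric]
    by (rule sum.cong) (auto simp: algebra_simps u0)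
  then show "(\<Sum>k<N. proj i k * proj k j) = proj i j" by (simp add: d p sum_uu u0)
qed

lemma comb_carrier [simp]: "comb a b c \<in> carrier_mat N N"
  by (simp add: comb_def)

lemma comb_index: "i < N \<Longrightarrow> j < N \<Longrightarrow>
   comb a b c $$ (i, j) = a * (if i = j then 1 else 0) + b * gen i j + c * proj i j"
  by (simp add: comb_def)

lemma comb_mult:
  "comb a b c * comb a' b' c' =
   comb (a * a') (a * b' + b * a' + b * c' + c * b') (a * c' + c * a' + c * c' - b * b')"
   (is "?L = ?R")
proof (rule eq_matI)
  fix i j assume "i < dim_row ?R" "j < dim_col ?R"
  then have ij: "i < N" "j < N" by (auto simp: comb_def)
  let ?d = "\<lambda>i j::nat. if i = j then 1 else (0::complex)"
  have dl: "(\<Sum>k<N. ?d i k * f k) = f i" for f using ij by (simp add: if_distrib[where f="\<lambda>x. x * _"] cong: if_cong)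
  have dr: "(\<Sum>k<N. f k * ?d k j) = f j" for f using ij by (simp add: if_distrib[where f="\<lambda>x. _ * x"] cong: if_cong)
  have "?L $$ (i, j) = (\<Sum>k<N. (a * ?d i k + b * gen i k + c * proj i k) * (a' * ?d k j + b' * gen k j + c' * proj k j))"
    using ij by (subst index_mult_mat_sum[of _ N]) (auto simp: comb_index intro!: sum.cong)
  also have "\<dots> = a * a' * (\<Sum>k<N. ?d i k * ?d k j) + a * b' * (\<Sum>k<N. ?d i k * gen k j) + a * c' * (\<Sum>k<N. ?d i k * proj k j)
     + b * a' * (\<Sum>k<N. gen i k * ?d k j) + b * b' * (\<Sum>k<N. gen i k * gen k j) + b * c' * (\<Sum>k<N. gen i k * proj k j)
     + c * a' * (\<Sum>k<N. proj i k * ?d k j) + c * b' * (\<Sum>k<N. proj i k * gen k j) + c * c' * (\<Sum>k<N. proj i k * proj k j)"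
    unfolding sum_distrib_left sum.distrib[symmetric]
    by (rule sum.cong[OF refl], simp only: distrib_left distrib_right mult_ac add_ac)
  also have "\<dots> = ?R $$ (i, j)"
    unfolding dl dr algebra_relations by (simp only: comb_index[OF ij]) (simp add: algebra_simps)
  finally show "?L $$ (i, j) = ?R $$ (i, j)" .
qed (auto simp: comb_def)

lemma comb_one: "comb 1 0 0 = 1\<^sub>m N"
  by (rule eq_matI) (auto simp: comb_def)

lemma comb_adjoint: "mat_adjoint (comb a b c) = comb (cnj a) (- cnj b) (cnj c)"
  by (rule eq_matI) (auto simp: comb_def dim_mat_adjoint index_mat_adjoint gen_def proj_def algebra_simps)

lemma trace_comb: "mat_trace (comb 0 b c) = 2 * c"
proof -
  have "mat_trace (comb 0 b c) = (\<Sum>i<N. c * (u i * cnj (u i)) + c * (if i = 0 then 1 else 0))"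
    unfolding mat_trace_def by (rule sum.cong) (auto simp: comb_def gen_def proj_def algebra_simps u0)
  also have "\<dots> = 2 * c" using N by (simp add: sum.distrib sum_distrib_left[symmetric] sum_uu)
  finally show ?thesis .
qed

text \<open>This is the exponential of \<open>t\<close> times \<open>gen\<close>, summed in closed form using that the square of
  \<open>gen\<close> is \<open>- proj\<close>.\<close>

definition rot :: "real \<Rightarrow> complex mat" where
  "rot t = comb 1 (of_real (sin t)) (of_real (cos t - 1))"

lemma rot_add: "rot s * rot t = rot (s + t)"
  unfolding rot_def comb_mult by (simp add: sin_add cos_add algebra_simps)

lemma rot_adjoint: "mat_adjoint (rot t) = rot (- t)"
  unfolding rot_def comb_adjoint by simp

lemma rot_zero: "rot 0 = 1\<^sub>m N" by (simp add: rot_def comb_one)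

text \<open>
  The reflection \<open>D\<close> in \<open>e\<^sub>0\<close> reverses the sense of rotation, so \<open>rot (-s)\<close> is conjugate to
  \<open>rot s\<close> and both have the same determinant. Being inverse to each other, they have determinant
  \<open>\<plusminus>1\<close>; and \<open>rot t\<close> is the square of \<open>rot (t/2)\<close>.
\<close>

lemma det_rot: "det (rot t) = 1"
proof -
  define D where "D = mat N N (\<lambda>(i, j). if i = j then (if i = 0 then -1 else 1) else (0::complex))"
  have D: "D \<in> carrier_mat N N" by (simp add: D_def)
  have R: "rot s \<in> carrier_mat N N" for s by (simp add: rot_def)
  have "rot (-s) * D = D * rot s" for s
  proof (rule eq_matI)
    fix i j assume "i < dim_row (D * rot s)" "j < dim_col (D * rot s)"
    then have ij: "i < N" "j < N" using D R[of s] by auto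
    have d: "(if c then x else 0) * y = (if c then x * y else 0)"
            "y * (if c then x else 0) = (if c then y * x else 0)" for c and x y :: complex by auto
    show "(rot (-s) * D) $$ (i, j) = (D * rot s) $$ (i, j)"
      unfolding index_mult_mat_sum[OF R D ij] index_mult_mat_sum[OF D R ij]
      using ij by (simp add: D_def d rot_def comb_index gen_def proj_def u0)
  qed (use D R[of s] R[of "- s"] in auto)
  then have "det (rot (-s)) * det D = det D * det (rot s)" for s
    using det_mult[OF R D] det_mult[OF D R] by metis
  moreover have "det D \<noteq> 0"
    by (subst det_upper_triangular[OF _ D]) (auto simp: D_def upper_triangular_def diag_mat_def prod_list_zero_iff)
  ultimately have "det (rot (-s)) = det (rot s)" for s by (metis mult.commute mult_cancel_left)
  then have "det (rot (t/2)) * det (rot (t/2)) = det (rot (t/2)) * det (rot (-(t/2)))" by metis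
  also have "\<dots> = det (rot (t/2) * rot (-(t/2)))" using det_mult[OF R R] by simp
  also have "\<dots> = 1" by (simp add: rot_add rot_zero)
  finally show ?thesis using det_mult[OF R R, of "t/2" "t/2"] by (simp add: rot_add)
qed

lemma rot_in_SU: "rot t \<in> SU N"
  unfolding SU_def using det_rot by (simp add: rot_adjoint rot_add rot_zero) (simp add: rot_def)

lemma rot_first_column:
  assumes "k < N"
  shows "rot t $$ (k, 0) = of_real (cos t) * (if k = 0 then 1 else 0) + of_real (sin t) * u k"
  using assms N by (simp add: rot_def comb_index gen_def proj_def u0)

lemma rot_carrier: "rot t \<in> carrier_mat N N" by (simp add: rot_def)

text \<open>
  Right multiplication is used because the metric trivialises tangent vectors by left
  translation: the factor \<open>g\<close> cancels, and the velocity of \<open>g * rot (\<theta> t)\<close> pulled back to the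
  identity is the constant \<open>\<theta>\<close> times \<open>gen\<close>, of norm \<open>\<theta>\<close>.
\<close>

lemma SU_dist_rot_le:
  assumes g: "g \<in> SU N" and \<theta>: "0 \<le> \<theta>"
  shows "SU_dist N g (g * rot \<theta>) \<le> ennreal \<theta>"
proof -
  define \<gamma> where "\<gamma> t = g * rot (\<theta> * t)" for t
  define vel where "vel t = comb 0 (of_real (\<theta> * cos (\<theta> * t))) (of_real (- \<theta> * sin (\<theta> * t)))" for t
  have gc: "g \<in> carrier_mat N N" and gg: "mat_adjoint g * g = 1\<^sub>m N" using g by (auto simp: SU_def)
  have vc: "vel t \<in> carrier_mat N N" for t by (simp add: vel_def)
  have deriv: "((\<lambda>s. \<gamma> s $$ (i, j)) has_vector_derivative (g * vel t) $$ (i, j)) (at t)"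
    if ij: "i < N" "j < N" for i j t
  proof -
    have "((\<lambda>s. rot (\<theta> * s) $$ (k, j)) has_vector_derivative vel t $$ (k, j)) (at t)" if "k < N" for k
    proof -
      have s: "((\<lambda>s. complex_of_real (sin (\<theta> * s))) has_vector_derivative of_real (\<theta> * cos (\<theta> * t))) (at t)"
        by (rule has_vector_derivative_of_real) (rule derivative_eq_intros refl | simp)+
      have c: "((\<lambda>s. complex_of_real (cos (\<theta> * s) - 1)) has_vector_derivative of_real (- \<theta> * sin (\<theta> * t))) (at t)"
        by (rule has_vector_derivative_of_real) (rule derivative_eq_intros refl | simp)+
      show ?thesis unfolding rot_def vel_def comb_index[OF that ij(2)]
        using has_vector_derivative_add[OF has_vector_derivative_add[OF has_vector_derivative_const
          has_vector_derivative_mult_left[OF s]] has_vector_derivative_mult_left[OF c]] by simp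
    qed
    then have "((\<lambda>s. \<Sum>k<N. g $$ (i, k) * rot (\<theta> * s) $$ (k, j)) has_vector_derivative
        (\<Sum>k<N. g $$ (i, k) * vel t $$ (k, j))) (at t)"
      by (intro has_vector_derivative_sum has_vector_derivative_mult_right) auto
    then show ?thesis
      by (simp only: \<gamma>_def index_mult_mat_sum[OF gc rot_carrier ij] index_mult_mat_sum[OF gc vc ij])
  qed
  have cont: "continuous_on {0..1} (\<lambda>t. (g * vel t) $$ (i, j))" if ij: "i < N" "j < N" for i j
    unfolding index_mult_mat_sum[OF gc vc ij]
  proof (intro continuous_on_sum continuous_on_mult_left)
    fix k assume "k \<in> {..<N}"
    then show "continuous_on {0..1} (\<lambda>t. vel t $$ (k, j))"
      unfolding vel_def using ij by (simp add: comb_index) (intro continuous_intros)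
  qed
  have "\<gamma> \<in> SU_paths N g (g * rot \<theta>)"
    unfolding SU_paths_def
  proof (intro CollectI conjI allI impI)
    show "\<gamma> \<in> {0..1} \<rightarrow> SU N" using SU_mult[OF g rot_in_SU] by (auto simp: \<gamma>_def)
    show "\<gamma> 0 = g" "\<gamma> 1 = g * rot \<theta>" using gc by (auto simp: \<gamma>_def rot_zero)
    fix i j assume "i < N" "j < N"
    then have "(\<lambda>t. \<gamma> t $$ (i, j)) C1_differentiable_on {0..1}"
      unfolding C1_differentiable_on_def
      by (intro exI[of _ "\<lambda>t. (g * vel t) $$ (i, j)"] conjI ballI deriv cont)
    then show "(\<lambda>t. \<gamma> t $$ (i, j)) piecewise_C1_differentiable_on {0..1}"
      by (rule C1_differentiable_imp_piecewise)
  qed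
  then have "SU_dist N g (g * rot \<theta>) \<le> SU_length N \<gamma>"
    unfolding SU_dist_def by (rule INF_lower)
  also have "SU_length N \<gamma> = (\<integral>\<^sup>+ t\<in>{0..1 :: real}. ennreal \<theta> \<partial>lborel)"
  proof -
    have speed: "sqrt (SU_metric (\<gamma> t) (mat_velocity N \<gamma> t) (mat_velocity N \<gamma> t)) = \<theta>" for t
    proof -
      have "mat_velocity N \<gamma> t = g * vel t"
        using gc vc[of t] unfolding mat_velocity_def
        by (intro eq_matI) (simp_all add: vector_derivative_at[OF deriv] del: index_mult_mat(1))
      then have "mat_adjoint (\<gamma> t) * mat_velocity N \<gamma> t = (rot (- (\<theta> * t)) * mat_adjoint g) * (g * vel t)"
        unfolding \<gamma>_def by (simp add: mat_adjoint_mult[OF gc rot_carrier] rot_adjoint)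
      also have "\<dots> = rot (- (\<theta> * t)) * ((mat_adjoint g * g) * vel t)"
        using gc vc[of t] rot_carrier[of "- (\<theta> * t)"] mat_adjoint_carrier[OF gc]
        by (simp add: assoc_mult_mat[of _ N N _ N _ N])
      also have "\<dots> = rot (- (\<theta> * t)) * vel t" using vc[of t] by (simp add: gg)
      also have "\<dots> = comb 0 (of_real \<theta>) 0"
      proof -
        \<comment> \<open>From here on only \<open>C\<^sup>2 + S\<^sup>2 = 1\<close> matters; the two identities are the coefficients
          produced by \<open>comb_mult\<close>.\<close>
        define C S where "C = complex_of_real (cos (\<theta> * t))" and "S = complex_of_real (sin (\<theta> * t))"
        have "C * C + S * S = 1"
          unfolding C_def S_def of_real_mult[symmetric] of_real_add[symmetric] by simp
        moreover have "1 * (of_real \<theta> * C) + - S * 0 + - S * (- of_real \<theta> * S) + (C - 1) * (of_real \<theta> * C)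
            = of_real \<theta> * (C * C + S * S)"
          and "1 * (- of_real \<theta> * S) + (C - 1) * 0 + (C - 1) * (- of_real \<theta> * S) - - S * (of_real \<theta> * C) = 0"
          by (simp_all add: algebra_simps)
        moreover have "rot (- (\<theta> * t)) = comb 1 (- S) (C - 1)"
          by (simp add: rot_def C_def S_def)
        moreover have "vel t = comb 0 (of_real \<theta> * C) (- of_real \<theta> * S)"
          by (simp add: vel_def C_def S_def)
        ultimately show ?thesis by (simp only: comb_mult mult_zero_right mult_1_right)
      qed
      finally show ?thesis using \<theta>
        unfolding SU_metric_def su_inner_def
        by (simp add: comb_mult trace_comb real_sqrt_mult)
    qed
    show ?thesis unfolding SU_length_def speed by (rule refl)
  qed
  also have "\<dots> = ennreal \<theta>"
    by (simp add: nn_integral_cmult_indicator)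
  finally show ?thesis .
qed

end

section \<open>Distance to the set over the hyperplane at infinity\<close>

lemma row_norm_SU:
  assumes "g \<in> SU N" "i < N"
  shows "(\<Sum>k<N. (cmod (g $$ (i, k)))\<^sup>2) = 1"
proof -
  have gc: "g \<in> carrier_mat N N" and gg: "mat_adjoint g * g = 1\<^sub>m N" using assms by (auto simp: SU_def)
  have "g * mat_adjoint g = 1\<^sub>m N"
    by (rule mat_mult_left_right_inverse[OF mat_adjoint_carrier[OF gc] gc gg])
  then have "(\<Sum>k<N. g $$ (i, k) * mat_adjoint g $$ (k, i)) = 1"
    using index_mult_mat_sum[OF gc mat_adjoint_carrier[OF gc] assms(2,2)] assms by simp
  then have "complex_of_real (\<Sum>k<N. (cmod (g $$ (i, k)))\<^sup>2) = 1"
    using gc assms unfolding of_real_sum complex_norm_square by (simp add: index_mat_adjoint)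
  then show ?thesis using of_real_eq_1_iff by blast
qed

lemma column_norm_SU:
  assumes "g \<in> SU N" "j < N"
  shows "(\<Sum>k<N. (cmod (g $$ (k, j)))\<^sup>2) = 1"
proof -
  have gc: "g \<in> carrier_mat N N" and gg: "mat_adjoint g * g = 1\<^sub>m N" using assms by (auto simp: SU_def)
  then have "(\<Sum>k<N. mat_adjoint g $$ (j, k) * g $$ (k, j)) = 1"
    using index_mult_mat_sum[OF mat_adjoint_carrier[OF gc] gc assms(2,2)] assms by simp
  then have "complex_of_real (\<Sum>k<N. (cmod (g $$ (k, j)))\<^sup>2) = 1"
    using gc assms unfolding of_real_sum complex_norm_square by (simp add: index_mat_adjoint mult.commute)
  then show ?thesis using of_real_eq_1_iff by blast
qed

lemma SU_over_infinityI:
  assumes s: "s \<in> SU (n + 1)" and "s $$ (0, 0) = 0"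
  shows "s \<in> SU_over_infinity n"
proof -
  let ?v = "s *\<^sub>v unit_vec (n + 1) 0"
  have sc: "s \<in> carrier_mat (n + 1) (n + 1)" using s by (simp add: SU_def)
  have v: "?v $ i = s $$ (i, 0)" if "i < n + 1" for i
    using sc that by simp
  have vc: "?v \<in> carrier_vec (n + 1)" using sc by simp
  have "?v \<noteq> 0\<^sub>v (n + 1)"
  proof
    assume "?v = 0\<^sub>v (n + 1)"
    then have "s $$ (i, 0) = 0" if "i < n + 1" for i using v[OF that] that by simp
    then show False using column_norm_SU[OF s, of 0] by simp
  qed
  then have "SU_proj n s \<in> CP n" using vc unfolding SU_proj_def CP_def by blast
  moreover have "w $ 0 = 0" if w: "w \<in> SU_proj n s" for w :: "complex vec"
  proof -
    obtain c where "w = c \<cdot>\<^sub>v ?v"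
      using w unfolding SU_proj_def proj_point_def by blast
    then show ?thesis using v[of 0] sc assms(2) by (simp del: index_mult_mat_vec)
  qed
  ultimately show ?thesis using s by (simp add: SU_over_infinity_def hyperplane_at_infinity_def)
qed

text \<open>
  Let \<open>|g\<^sub>0\<^sub>0| = r = sin \<theta>\<close> and \<open>q = cos \<theta>\<close>, so that the rest of row \<open>0\<close> has norm \<open>q\<close>.
  Rotating by an angle \<open>t\<close> turns the corner entry into \<open>g\<^sub>0\<^sub>0 cos t + (row \<cdot> u) sin t\<close>. Choosing \<open>u\<close>
  proportional to the conjugate of the rest of the row, with the phase opposite to that of
  \<open>g\<^sub>0\<^sub>0\<close>, makes this a phase times \<open>r cos t - q sin t\<close>, which vanishes at \<open>t = \<theta>\<close>.
\<close>

lemma exists_close_point_over_infinity: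
  assumes g: "g \<in> SU (n + 1)" and less: "cmod (g $$ (0, 0)) < 1"
  obtains s where "s \<in> SU_over_infinity n"
    "SU_dist (n + 1) g s \<le> ennreal (arcsin (cmod (g $$ (0, 0))))"
proof -
  let ?N = "n + 1"
  define r where "r = cmod (g $$ (0, 0))"
  \<comment> \<open>The phase must have modulus \<open>1\<close> even when the entry is \<open>0\<close>, which \<open>sgn\<close> would not give.\<close>
  define c where "c = cis (Arg (g $$ (0, 0)))"
  define q where "q = sqrt (1 - r\<^sup>2)"
  define u where "u k = (if k = 0 then 0 else - c * cnj (g $$ (0, k)) / of_real q)" for k
  have r: "0 \<le> r" "r < 1" using less by (auto simp: r_def)
  have c: "g $$ (0, 0) = c * of_real r" "cmod c = 1"
    using rcis_cmod_Arg[of "g $$ (0, 0)"] by (auto simp: c_def r_def rcis_def mult.commute)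
  have "r\<^sup>2 < 1" using r by (simp add: power_less_one_iff)
  then have q: "q > 0" "q\<^sup>2 = 1 - r\<^sup>2" by (auto simp: q_def)
  have row: "(\<Sum>k<n. (cmod (g $$ (0, Suc k)))\<^sup>2) = q\<^sup>2"
    using row_norm_SU[OF g, of 0] q unfolding Suc_eq_plus1[symmetric] sum.lessThan_Suc_shift by (simp add: r_def)
  have "(\<Sum>k<?N. (cmod (u k))\<^sup>2) = (\<Sum>k<n. (cmod (g $$ (0, Suc k)))\<^sup>2 / q\<^sup>2)"
    unfolding Suc_eq_plus1[symmetric] sum.lessThan_Suc_shift using q c
    by (simp add: u_def norm_mult norm_divide power_divide)
  also have "\<dots> = 1" using q(1) by (simp add: row flip: sum_divide_distrib)
  finally interpret coordinate_plane ?N u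
    by unfold_locales (auto simp: u_def)
  have gc: "g \<in> carrier_mat ?N ?N" using g by (simp add: SU_def)
  define s where "s = g * rot (arcsin r)"
  have sin: "sin (arcsin r) = r" using r by simp
  have cos: "cos (arcsin r) = q" using r by (simp add: cos_arcsin q_def)
  have gu: "(\<Sum>k<?N. g $$ (0, k) * u k) = - c * of_real q"
  proof -
    have "(\<Sum>k<?N. g $$ (0, k) * u k) = (\<Sum>k<n. - c / of_real q * of_real ((cmod (g $$ (0, Suc k)))\<^sup>2))"
      unfolding Suc_eq_plus1[symmetric] sum.lessThan_Suc_shift complex_norm_square
      by (simp add: u_def mult_ac)
    also have "\<dots> = - c / of_real q * of_real (q\<^sup>2)"
      unfolding row[symmetric] by (simp add: sum_distrib_left)
    also have "\<dots> = - c * of_real q" using q(1) by (simp add: power2_eq_square)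
    finally show ?thesis .
  qed
  have "s $$ (0, 0) = (\<Sum>k<?N. g $$ (0, k) * rot (arcsin r) $$ (k, 0))"
    unfolding s_def by (rule index_mult_mat_sum[OF gc rot_carrier]) auto
  also have "\<dots> = (\<Sum>k<?N. of_real q * (if k = 0 then g $$ (0, 0) else 0) + of_real r * (g $$ (0, k) * u k))"
    by (rule sum.cong[OF refl]) (simp only: lessThan_iff rot_first_column sin cos, simp add: algebra_simps)
  also have "\<dots> = of_real q * g $$ (0, 0) + of_real r * (\<Sum>k<?N. g $$ (0, k) * u k)"
    by (simp add: sum.distrib flip: sum_distrib_left)
  also have "\<dots> = 0" unfolding gu c(1) by simp
  finally have "s \<in> SU_over_infinity n"
    using SU_mult[OF g rot_in_SU] by (intro SU_over_infinityI) (auto simp: s_def)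
  moreover have "SU_dist ?N g s \<le> ennreal (arcsin r)"
    unfolding s_def using r by (intro SU_dist_rot_le[OF g]) (simp add: arcsin_nonneg)
  ultimately show ?thesis using that by (auto simp: r_def)
qed

section \<open>Haar measure of the matrices with a large corner entry\<close>

definition large_entry :: "nat \<Rightarrow> real \<Rightarrow> nat \<Rightarrow> complex mat set" where
  "large_entry N \<delta> i = {g \<in> SU N. \<delta> \<le> cmod (g $$ (i, 0))}"

lemma large_entry_measurable:
  assumes "normalised_Haar_SU N \<mu>" "i < N"
  shows "large_entry N \<delta> i \<in> sets \<mu>"
proof -
  let ?T = "product_topology (\<lambda>_. euclidean :: complex topology) ({..<N} \<times> {..<N})"
  \<comment> \<open>The set is closed: its complement is the preimage of an open disc under an entry map.\<close>
  define U where "U = {x \<in> topspace ?T. x (i, 0) \<in> ball 0 \<delta>}"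
  have "openin ?T U" unfolding U_def
    using assms(2) by (intro openin_continuous_map_preimage[of ?T euclidean]) (auto intro!: continuous_map_product_projection)
  then have "openin (SU_topology N) ((\<lambda>A. \<lambda>p\<in>{..<N} \<times> {..<N}. A $$ p) -` U \<inter> SU N)"
    unfolding SU_topology_def openin_pullback_topology by blast
  also have "(\<lambda>A. \<lambda>p\<in>{..<N} \<times> {..<N}. A $$ p) -` U \<inter> SU N = {g \<in> SU N. cmod (g $$ (i, 0)) < \<delta>}"
    using assms(2) by (auto simp: U_def)
  finally have "{g \<in> SU N. cmod (g $$ (i, 0)) < \<delta>} \<in> sets \<mu>"
    using assms(1) by (auto simp: normalised_Haar_SU_def)
  then have "space \<mu> - {g \<in> SU N. cmod (g $$ (i, 0)) < \<delta>} \<in> sets \<mu>" by (rule sets.compl_sets)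
  also have "space \<mu> - {g \<in> SU N. cmod (g $$ (i, 0)) < \<delta>} = large_entry N \<delta> i"
    using assms(1) by (auto simp: normalised_Haar_SU_def large_entry_def)
  finally show ?thesis .
qed

text \<open>The quarter turn in the plane of \<open>e\<^sub>0\<close> and \<open>e\<^sub>i\<close> moves row \<open>0\<close> to row \<open>i\<close>. Unlike
  the transposition of the two rows, it has determinant \<open>1\<close>.\<close>

lemma exists_row_moving_rotation:
  assumes "0 < i" "i < N"
  obtains p where "p \<in> SU N" "\<And>g. g \<in> carrier_mat N N \<Longrightarrow> (p * g) $$ (i, 0) = g $$ (0, 0)"
proof -
  interpret coordinate_plane N "\<lambda>k. if k = i then 1 else 0"
    using assms by unfold_locales (simp_all add: if_distrib[of "\<lambda>z. (cmod z)\<^sup>2"] cong: if_cong)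
  have "(rot (pi / 2) * g) $$ (i, 0) = g $$ (0, 0)" if g: "g \<in> carrier_mat N N" for g
  proof -
    have "(rot (pi / 2) * g) $$ (i, 0) = (\<Sum>k<N. rot (pi / 2) $$ (i, k) * g $$ (k, 0))"
      using assms by (intro index_mult_mat_sum[OF rot_carrier g]) auto
    also have "\<dots> = (\<Sum>k<N. if k = 0 then g $$ (k, 0) else 0)"
      using assms by (intro sum.cong) (auto simp: rot_def comb_index gen_def proj_def)
    finally show ?thesis using assms by simp
  qed
  then show ?thesis using rot_in_SU that by blast
qed

text \<open>The sets for different rows are left translates of each other.\<close>

lemma Haar_large_entry_eq:
  assumes haar: "normalised_Haar_SU N \<mu>" and i: "i < N"
  shows "emeasure \<mu> (large_entry N \<delta> i) = emeasure \<mu> (large_entry N \<delta> 0)"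
proof (cases "i = 0")
  case False
  then obtain p where p: "p \<in> SU N"
    and pg: "\<And>g. g \<in> carrier_mat N N \<Longrightarrow> (p * g) $$ (i, 0) = g $$ (0, 0)"
    using exists_row_moving_rotation i by blast
  have "(\<lambda>h. p * h) ` large_entry N \<delta> 0 = large_entry N \<delta> i"
  proof (intro equalityI subsetI)
    fix h assume "h \<in> (\<lambda>h. p * h) ` large_entry N \<delta> 0"
    then show "h \<in> large_entry N \<delta> i" using p pg SU_mult SU_carrier by (auto simp: large_entry_def)
  next
    fix h assume h: "h \<in> large_entry N \<delta> i"
    then have hS: "h \<in> SU N" by (simp add: large_entry_def)
    define g where "g = mat_adjoint p * h"
    have g: "g \<in> SU N" unfolding g_def by (intro SU_mult SU_adjoint p hS)
    have "p * g = (p * mat_adjoint p) * h"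
      unfolding g_def using SU_carrier[OF p] SU_carrier[OF hS] mat_adjoint_carrier[OF SU_carrier[OF p]]
      by (simp add: assoc_mult_mat[of _ N N _ N _ N])
    also have "\<dots> = h" using SU_right_inverse[OF p] SU_carrier[OF hS] by simp
    finally have "h = p * g" ..
    moreover have "g \<in> large_entry N \<delta> 0"
      using h g pg[OF SU_carrier[OF g]] \<open>h = p * g\<close> by (simp add: large_entry_def)
    ultimately show "h \<in> (\<lambda>h. p * h) ` large_entry N \<delta> 0" by blast
  qed
  moreover have "large_entry N \<delta> 0 \<in> sets \<mu>"
    using large_entry_measurable[OF haar] i by simp
  ultimately show ?thesis
    using haar p unfolding normalised_Haar_SU_def by (metis (no_types))
qed simp

text \<open>
  Markov's inequality for the squared moduli of column \<open>0\<close>, applied to all rows at once: the number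
  of \<open>i\<close> with \<open>|g\<^sub>i\<^sub>0| \<ge> \<delta>\<close> is at most \<open>1/\<delta>\<^sup>2\<close> pointwise, and its expectation is \<open>N\<close>
  times the measure in question.
\<close>

lemma Haar_large_entry_le:
  assumes haar: "normalised_Haar_SU N \<mu>" and N: "0 < N" and \<delta>: "0 < \<delta>"
  shows "measure \<mu> (large_entry N \<delta> 0) \<le> 1 / (\<delta>\<^sup>2 * N)"
proof -
  have sp: "space \<mu> = SU N" and one: "emeasure \<mu> (space \<mu>) = 1"
    using haar by (auto simp: normalised_Haar_SU_def)
  interpret finite_measure \<mu> by (rule finite_measureI) (simp add: one)
  have meas: "large_entry N \<delta> i \<in> sets \<mu>" if "i < N" for i
    using large_entry_measurable[OF haar that] .
  have eq: "measure \<mu> (large_entry N \<delta> i) = measure \<mu> (large_entry N \<delta> 0)" if "i < N" for i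
    unfolding measure_def Haar_large_entry_eq[OF haar that] ..
  have "real N * measure \<mu> (large_entry N \<delta> 0) = (\<Sum>i<N. measure \<mu> (large_entry N \<delta> 0))"
    by simp
  also have "\<dots> = (\<Sum>i<N. measure \<mu> (large_entry N \<delta> i))"
    by (intro sum.cong refl) (rule eq[symmetric], simp)
  also have "\<dots> = (\<integral>g. (\<Sum>i<N. indicator (large_entry N \<delta> i) g) \<partial>\<mu>)"
    using meas by (subst Bochner_Integration.integral_sum) (auto simp: less_top[symmetric])
  also have "\<dots> \<le> (\<integral>g. 1 / \<delta>\<^sup>2 \<partial>\<mu>)"
  proof (rule integral_mono)
    fix g assume "g \<in> space \<mu>"
    then have g: "g \<in> SU N" by (simp add: sp)
    have "(\<Sum>i<N. indicator (large_entry N \<delta> i) g) \<le> (\<Sum>i<N. (cmod (g $$ (i, 0)))\<^sup>2 / \<delta>\<^sup>2)"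
    proof (rule sum_mono)
      fix i
      have "1 \<le> (cmod (g $$ (i, 0)))\<^sup>2 / \<delta>\<^sup>2" if "g \<in> large_entry N \<delta> i"
        using that \<delta> by (simp add: large_entry_def power_mono)
      then show "indicator (large_entry N \<delta> i) g \<le> (cmod (g $$ (i, 0)))\<^sup>2 / \<delta>\<^sup>2"
        by (cases "g \<in> large_entry N \<delta> i") simp_all
    qed
    also have "\<dots> = 1 / \<delta>\<^sup>2" using column_norm_SU[OF g N] by (simp flip: sum_divide_distrib)
    finally show "(\<Sum>i<N. indicator (large_entry N \<delta> i) g) \<le> 1 / \<delta>\<^sup>2" .
  qed (use meas in \<open>auto simp: less_top[symmetric]\<close>)
  also have "\<dots> = 1 / \<delta>\<^sup>2" using one by (simp add: measure_def)
  finally have "measure \<mu> (large_entry N \<delta> 0) \<le> 1 / \<delta>\<^sup>2 / real N"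
    using N by (simp only: pos_le_divide_eq of_nat_0_less_iff mult.commute)
  then show ?thesis by simp
qed

section \<open>Concentration\<close>

text \<open>Capping the radius at \<open>1 < \<pi>/2\<close> keeps \<open>arcsin (sin _)\<close> the identity; a smaller tube only
  enlarges the complement.\<close>

lemma large_entry_outside_tube:
  assumes "\<epsilon> > 0"
  shows "SU (n + 1) - tubular_nbhd (n + 1) (SU_over_infinity n) \<epsilon>
    \<subseteq> large_entry (n + 1) (sin (min \<epsilon> 1)) 0"
proof (rule subsetI, rule ccontr)
  fix g
  assume "g \<in> SU (n + 1) - tubular_nbhd (n + 1) (SU_over_infinity n) \<epsilon>"
    and "g \<notin> large_entry (n + 1) (sin (min \<epsilon> 1)) 0"
  then have g: "g \<in> SU (n + 1)"
    and out: "g \<notin> tubular_nbhd (n + 1) (SU_over_infinity n) \<epsilon>"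
    and small: "cmod (g $$ (0, 0)) < sin (min \<epsilon> 1)"
    by (simp_all add: large_entry_def)
  let ?e = "min \<epsilon> 1"
  have e: "0 < ?e" "?e < pi / 2" using assms pi_gt3 by auto
  have lt1: "cmod (g $$ (0, 0)) < 1" using small sin_le_one order_less_le_trans by blast
  have "arcsin (cmod (g $$ (0, 0))) < arcsin (sin ?e)"
    using small by (intro arcsin_less_arcsin) (auto intro: order_trans[OF _ norm_ge_zero])
  also have "arcsin (sin ?e) = ?e" using e by (intro arcsin_sin) auto
  finally have a: "arcsin (cmod (g $$ (0, 0))) < \<epsilon>" by simp
  obtain s where s: "s \<in> SU_over_infinity n" "SU_dist (n + 1) g s \<le> ennreal (arcsin (cmod (g $$ (0, 0))))"
    using exists_close_point_over_infinity[OF g lt1] .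
  have "(INF s\<in>SU_over_infinity n. SU_dist (n + 1) g s) \<le> SU_dist (n + 1) g s"
    using s(1) by (rule INF_lower)
  also note s(2)
  also have "ennreal (arcsin (cmod (g $$ (0, 0)))) < ennreal \<epsilon>"
    using assms a by (rule ennreal_lessI)
  finally show False using out g by (simp add: tubular_nbhd_def)
qed

theorem proposition1:
  fixes \<mu> :: "nat \<Rightarrow> complex mat measure" and \<epsilon> :: real
  assumes "\<And>n. n \<ge> 1 \<Longrightarrow> normalised_Haar_SU (n + 1) (\<mu> n)"
    and "\<epsilon> > 0"
  shows "(\<lambda>n. measure (\<mu> n)
           (SU (n + 1) - tubular_nbhd (n + 1) (SU_over_infinity n) \<epsilon>)) \<longlonglongrightarrow> 0"
proof (rule tendsto_sandwich[OF _ _ tendsto_const])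
  define \<delta> where "\<delta> = sin (min \<epsilon> 1)"
  have \<delta>: "0 < \<delta>" unfolding \<delta>_def using assms(2) pi_gt3 by (intro sin_gt_zero) auto
  show "\<forall>\<^sub>F n in sequentially. measure (\<mu> n)
      (SU (n + 1) - tubular_nbhd (n + 1) (SU_over_infinity n) \<epsilon>) \<le> 1 / \<delta>\<^sup>2 * inverse (real (Suc n))"
  proof (rule eventually_sequentiallyI[of 1])
    fix n :: nat assume "1 \<le> n"
    let ?A = "SU (n + 1) - tubular_nbhd (n + 1) (SU_over_infinity n) \<epsilon>"
    have haar: "normalised_Haar_SU (n + 1) (\<mu> n)" using assms(1) \<open>1 \<le> n\<close> .
    then interpret finite_measure "\<mu> n"
      by (intro finite_measureI) (simp add: normalised_Haar_SU_def)
    have "measure (\<mu> n) ?A \<le> measure (\<mu> n) (large_entry (n + 1) \<delta> 0)"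
      unfolding \<delta>_def
      by (rule finite_measure_mono[OF large_entry_outside_tube[OF assms(2)] large_entry_measurable[OF haar]]) simp
    also have "\<dots> \<le> 1 / (\<delta>\<^sup>2 * real (n + 1))"
      by (rule Haar_large_entry_le[OF haar _ \<delta>]) simp
    finally show "measure (\<mu> n) ?A \<le> 1 / \<delta>\<^sup>2 * inverse (real (Suc n))"
      by (simp add: field_simps)
  qed
  show "(\<lambda>n. 1 / \<delta>\<^sup>2 * inverse (real (Suc n))) \<longlonglongrightarrow> 0"
    using tendsto_mult[OF tendsto_const LIMSEQ_inverse_real_of_nat, of "1 / \<delta>\<^sup>2"] by simp
qed simp

end
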